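(* Let $\Gamma=(\Gamma,\cdot)$ be an abelian (discrete) group acting on a measure space $X=(X,\mathcal{X},\mu)$ in a measure-preserving way, and suppose that $F\odot A=_{\mathrm{a.e.}}X$ for some finite set $F\subset\Gamma$ and some measurable $A\subset X$. (i) (Dilation lemma) One has $F^r\odot A=_{\mathrm{a.e.}}X$ whenever $r$ is an integer coprime to $|F|$. (ii) (Structure theorem) Suppose that $\mu(X)$ is finite. Let $q=|F|$. Then there is a decomposition $$\mathbf{1}_X=_{\mathrm{a.e.}}\sum_{f\in F}\varphi_f,$$ where for each $f\in F$, $\varphi_f\colon X\to[0,1]$ is a measurable function which is $f^q$-invariant up to null sets, i.e. $\varphi_f(f^q\cdot x)=\varphi_f(x)$ for $\mu$-almost every $x\in X$. Furthermore, for all $f\in F$ we have $\int_X\varphi_f\,d\mu=\mu(A)$, and if $f^q\cdot A=_{\mathrm{a.e.}}A$ then $\varphi_f=_{\mathrm{a.e.}}\mathbf{1}_{f\cdot A}$.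
   Context: A measure-preserving action of $\Gamma$ on $(X,\mathcal{X},\mu)$ is a group action $(\gamma,x)\mapsto\gamma\cdot x$ such that each map $x\mapsto\gamma\cdot x$ is measurable and preserves $\mu$. For a finite set $F\subset\Gamma$ and a measurable set $A\subset X$, $F\odot A=_{\mathrm{a.e.}}X$ means that the translates $f\cdot A=\{f\cdot a: a\in A\}$, $f\in F$, partition $X$ up to $\mu$-null sets (distinct translates have $\mu$-null intersection and the union of all translates is $\mu$-conull). For an integer $r$, $F^r=\{f^r: f\in F\}$. For functions, $\varphi=_{\mathrm{a.e.}}\psi$ means $\varphi,\psi$ agree $\mu$-almost everywhere; for sets, $B=_{\mathrm{a.e.}}C$ means $B$ and $C$ differ by a $\mu$-null set. $\mathbf{1}_B$ is the indicator function of $B$ and $|F|$ is the cardinality of $F$. *)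

theory Defs
  imports "HOL-Analysis.Analysis" "HOL-Algebra.Group_Action"
begin

text \<open>The locale \<^locale>\<open>group_action\<close> takes its maps from \<^const>\<open>BijGroup\<close>, so \<open>\<phi> \<gamma>\<close> is a bijection of
  \<open>space M\<close> that is \<open>undefined\<close> outside \<open>space M\<close>. No topology on the group and no finiteness
  condition on the measure is assumed.\<close>

locale measure_preserving_action = group_action G "space M" \<phi>
  for G :: "('g, 'm) monoid_scheme" (structure)
    and M :: "'x measure"
    and \<phi> :: "'g \<Rightarrow> 'x \<Rightarrow> 'x" +
  assumes act_measurable: "\<gamma> \<in> carrier G \<Longrightarrow> \<phi> \<gamma> \<in> M \<rightarrow>\<^sub>M M"
    and act_preserves: "\<gamma> \<in> carrier G \<Longrightarrow> B \<in> sets M \<Longrightarrow>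
      emeasure M (\<phi> \<gamma> -` B \<inter> space M) = emeasure M B"

definition ae_eq_set :: "'x measure \<Rightarrow> 'x set \<Rightarrow> 'x set \<Rightarrow> bool"
  where "ae_eq_set M B C \<longleftrightarrow> sym_diff B C \<in> null_sets M"

text \<open>\<open>F \<odot> A =\<^sub>a\<^sub>.\<^sub>e\<^sub>. X\<close>. The translates are indexed by the elements of \<open>F\<close>: distinct \<open>f, g \<in> F\<close> must
  have null overlap even if \<open>f \<cdot> A\<close> and \<open>g \<cdot> A\<close> coincide as sets.\<close>

definition ae_tiling :: "'x measure \<Rightarrow> ('g \<Rightarrow> 'x \<Rightarrow> 'x) \<Rightarrow> 'g set \<Rightarrow> 'x set \<Rightarrow> bool"
  where "ae_tiling M \<phi> F A \<longleftrightarrow>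
    (\<forall>f\<in>F. \<forall>g\<in>F. f \<noteq> g \<longrightarrow> \<phi> f ` A \<inter> \<phi> g ` A \<in> null_sets M) \<and>
    space M - (\<Union>f\<in>F. \<phi> f ` A) \<in> null_sets M"

definition set_int_pow :: "('g, 'm) monoid_scheme \<Rightarrow> 'g set \<Rightarrow> int \<Rightarrow> 'g set"
  where "set_int_pow G F r = (\<lambda>f. f [^]\<^bsub>G\<^esub> r) ` F"

end

theory Submission
  imports Defs "HOL-Number_Theory.Residues"
begin

text \<open>
  Both parts rest on counting with multiplicity. For a finite family \<open>a\<close> of group elements, call
  \<open>x \<mapsto> \<Sum>\<^sub>i 1\<^sub>A (a\<^sub>i \<cdot> x)\<close> its covering multiplicity; the hypothesis says that the family of inverses
  of the elements of \<open>F\<close> has multiplicity \<open>1\<close> almost everywhere. Let \<open>N\<close> be the operator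
  \<open>u \<mapsto> (x \<mapsto> \<Sum>\<^sub>i u (a\<^sub>i \<cdot> x))\<close>, so that \<open>N 1\<^sub>A = 1\<close> almost everywhere.

  Dilation. The shifts commute, so Frobenius modulo a prime \<open>p\<close> (\<open>shift_sum_frobenius\<close>) says that
  the multiplicity of the \<open>p\<close>-th powers is congruent to \<open>N\<^sup>p 1\<^sub>A = |F|\<^sup>p\<^sup>-\<^sup>1\<close>, hence to \<open>1\<close> if \<open>p\<close> does
  not divide \<open>|F|\<close>. In particular this multiplicity \<open>h\<close> is at least \<open>1\<close>. A covering by as
  many translates as a tiling uses is itself a tiling (\<open>tiles_by_equal_card\<close>): commuting the shifts
  gives \<open>N h = |F| = N 1\<close>, and \<open>N (h - 1) = 0\<close> with \<open>h - 1 \<ge> 0\<close> forces \<open>h = 1\<close>. This argument involves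
  no integration, so it covers infinite measures. The same principle for packings gives the
  exponent \<open>-1\<close>, and factoring the exponent into primes gives the rest.

  Structure. With \<open>q = |F|\<close>, every exponent \<open>1 - q k\<close> is coprime to \<open>q\<close>, so by dilation the functions
  \<open>x \<mapsto> 1\<^bsub>f A\<^esub> (f\<^sup>q\<^sup>k \<cdot> x)\<close>, \<open>f \<in> F\<close>, sum to \<open>1\<close> for every \<open>k\<close>, and hence so do their Birkhoff averages
  over \<open>k < n\<close> along \<open>f\<^sup>q\<close>. Take \<open>\<phi>\<^sub>f\<close> to be the upper limit of these averages: it is invariant under
  \<open>f\<^sup>q\<close>, has values in \<open>[0,1]\<close>, and equals \<open>1\<^bsub>f A\<^esub>\<close> if \<open>A\<close> is \<open>f\<^sup>q\<close>-invariant. Upper limits are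
  subadditive, so \<open>\<Sum> \<phi>\<^sub>f \<ge> 1\<close>. On the other hand \<open>\<integral> \<phi>\<^sub>f \<le> \<mu>(A)\<close> by the nontrivial half of the
  pointwise ergodic theorem (\<open>integral_upper_average_le\<close>), while \<open>q \<mu>(A) = \<mu>(X)\<close>. All these
  inequalities must therefore be equalities, and convergence of the averages is never at issue.
\<close>

section \<open>Frobenius for sums of commuting shifts\<close>

definition shift_sum :: "('i \<Rightarrow> 'x \<Rightarrow> 'x) \<Rightarrow> 'i set \<Rightarrow> ('x \<Rightarrow> int) \<Rightarrow> 'x \<Rightarrow> int"
  where "shift_sum T I u x = (\<Sum>i\<in>I. u (T i x))"

lemma shift_sum_linear:
  "shift_sum T I (\<lambda>x. \<Sum>k\<in>K. c k * v k x) x = (\<Sum>k\<in>K. c k * shift_sum T I (v k) x)"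
  unfolding shift_sum_def by (simp add: sum_distrib_left) (rule sum.swap)

lemma shift_sum_funpow_commute:
  assumes "\<And>i x. i \<in> I \<Longrightarrow> S (T i x) = T i (S x)"
  shows "(shift_sum T I ^^ k) u (S x) = (shift_sum T I ^^ k) (\<lambda>y. u (S y)) x"
proof (induction k arbitrary: x)
  case (Suc k)
  then show ?case
    using assms by (simp add: shift_sum_def flip: assms)
qed simp

text \<open>Pascal's rule, in the form in which it drives the induction step of a binomial theorem: \<open>g k l\<close>
  stands for a product of \<open>k\<close> factors of one kind and \<open>l\<close> of another.\<close>

lemma sum_pascal:
  fixes g :: "nat \<Rightarrow> nat \<Rightarrow> int"
  shows "(\<Sum>k\<le>n. int (n choose k) * (g (Suc k) (n - k) + g k (Suc (n - k)))) =
    (\<Sum>k\<le>Suc n. int (Suc n choose k) * g k (Suc n - k))"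
proof -
  have *: "(\<Sum>k\<le>Suc n. int (Suc n choose k) * g k (Suc n - k)) =
      g 0 (Suc n) + (\<Sum>k\<le>n. int (n choose k) * g (Suc k) (n - k)) +
        (\<Sum>k\<le>n. int (n choose Suc k) * g (Suc k) (n - k))"
    by (simp only: sum.atMost_Suc_shift) (simp add: sum.distrib algebra_simps)
  have "(\<Sum>k\<le>n. int (n choose Suc k) * g (Suc k) (n - k)) + g 0 (Suc n) =
      (\<Sum>k\<le>Suc n. int (n choose k) * g k (Suc n - k))"
    by (simp only: sum.atMost_Suc_shift) simp
  also have "\<dots> = (\<Sum>k\<le>n. int (n choose k) * g k (Suc (n - k)))"
    by (simp add: Suc_diff_le)
  finally show ?thesis
    using * by (simp add: sum.distrib algebra_simps)
qed

text \<open>The binomial theorem for \<open>N + S\<close>, where \<open>N\<close> is the shift sum over \<open>I\<close> and \<open>S\<close> the shift by \<open>T j\<close>.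
  The shift is kept inside the argument of \<open>N\<close>, which is legitimate because the two commute.\<close>

lemma shift_sum_insert_funpow:
  assumes "finite I" "j \<notin> I"
    and comm: "\<And>i x. i \<in> I \<Longrightarrow> T j (T i x) = T i (T j x)"
  shows "(shift_sum T (insert j I) ^^ n) u x =
    (\<Sum>k\<le>n. int (n choose k) * (shift_sum T I ^^ k) (\<lambda>y. u ((T j ^^ (n - k)) y)) x)"
proof (induction n arbitrary: x)
  case (Suc n)
  define N where "N k l = (shift_sum T I ^^ k) (\<lambda>y. u ((T j ^^ l) y)) x" for k l
  let ?v = "\<lambda>k. (shift_sum T I ^^ k) (\<lambda>y. u ((T j ^^ (n - k)) y))"
  have "(shift_sum T (insert j I) ^^ Suc n) u x =
      shift_sum T (insert j I) (\<lambda>x. \<Sum>k\<le>n. int (n choose k) * ?v k x) x"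
    by (simp only: funpow.simps o_apply Suc.IH[abs_def])
  also have "\<dots> = (\<Sum>k\<le>n. int (n choose k) * shift_sum T (insert j I) (?v k) x)"
    by (rule shift_sum_linear)
  also have "\<dots> = (\<Sum>k\<le>n. int (n choose k) * (N (Suc k) (n - k) + N k (Suc (n - k))))"
  proof (intro sum.cong refl arg_cong2[of _ _ _ _ "(*)"])
    fix k
    have "?v k (T j x) = N k (Suc (n - k))"
      unfolding N_def funpow_Suc_right o_def
      by (rule shift_sum_funpow_commute) (rule comm)
    moreover have "shift_sum T I (?v k) x = N (Suc k) (n - k)"
      by (simp add: N_def)
    ultimately show "shift_sum T (insert j I) (?v k) x = N (Suc k) (n - k) + N k (Suc (n - k))"
      using assms(1,2) by (simp add: shift_sum_def)
  qed
  also have "\<dots> = (\<Sum>k\<le>Suc n. int (Suc n choose k) * N k (Suc n - k))"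
    by (rule sum_pascal)
  finally show ?case
    unfolding N_def .
qed simp

text \<open>The middle binomial coefficients are divisible by \<open>p\<close>, so the \<open>p\<close>-th power is additive modulo \<open>p\<close>;
  splitting off one shift at a time reduces the sum to its individual shifts.\<close>

lemma shift_sum_frobenius:
  fixes p :: nat
  assumes "finite I" "prime p"
    and comm: "\<And>i j x. i \<in> I \<Longrightarrow> j \<in> I \<Longrightarrow> T j (T i x) = T i (T j x)"
  shows "[(shift_sum T I ^^ p) u x = (\<Sum>i\<in>I. u ((T i ^^ p) x))] (mod int p)"
  using assms(1) comm
proof (induction I)
  case empty
  have "p \<noteq> 0"
    using assms(2) by auto
  then obtain m where "p = Suc m"
    by (cases p) auto
  then show ?case
    by (simp add: shift_sum_def)
next
  case (insert j I)
  let ?t = "\<lambda>k. int (p choose k) * (shift_sum T I ^^ k) (\<lambda>y. u ((T j ^^ (p - k)) y)) x"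
  have "[(\<Sum>k\<in>{0<..<p}. ?t k) = (\<Sum>k\<in>{0<..<p}. 0)] (mod int p)"
    using assms(2) by (intro cong_sum) (auto simp: cong_0_iff dvd_choose_prime)
  then have "[u ((T j ^^ p) x) + (shift_sum T I ^^ p) u x + (\<Sum>k\<in>{0<..<p}. ?t k) =
      u ((T j ^^ p) x) + (shift_sum T I ^^ p) u x + 0] (mod int p)"
    by (intro cong_add cong_refl) simp
  moreover have "{..p} = insert 0 (insert p {0<..<p})" "0 < p"
    using prime_gt_0_nat[OF assms(2)] by auto
  then have "(\<Sum>k\<le>p. ?t k) =
      u ((T j ^^ p) x) + (shift_sum T I ^^ p) u x + (\<Sum>k\<in>{0<..<p}. ?t k)"
    by simp
  moreover have "(shift_sum T (insert j I) ^^ p) u x = (\<Sum>k\<le>p. ?t k)"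
    using insert by (intro shift_sum_insert_funpow) auto
  ultimately have "[(shift_sum T (insert j I) ^^ p) u x =
      u ((T j ^^ p) x) + (shift_sum T I ^^ p) u x] (mod int p)"
    by simp
  moreover have "[(shift_sum T I ^^ p) u x = (\<Sum>i\<in>I. u ((T i ^^ p) x))] (mod int p)"
    using insert by auto
  ultimately show ?case
    using insert.hyps by simp (meson cong_add_lcancel cong_trans)
qed

section \<open>Tilings by families of group elements\<close>

locale abelian_measure_preserving_action =
  measure_preserving_action G M \<phi> + comm_group G
  for G :: "('g, 'm) monoid_scheme" (structure)
    and M :: "'x measure"
    and \<phi> :: "'g \<Rightarrow> 'x \<Rightarrow> 'x"
begin

lemma act_in_space: "g \<in> carrier G \<Longrightarrow> x \<in> space M \<Longrightarrow> \<phi> g x \<in> space M"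
  using element_image by blast

lemma act_mult: "g \<in> carrier G \<Longrightarrow> h \<in> carrier G \<Longrightarrow> x \<in> space M \<Longrightarrow> \<phi> (g \<otimes> h) x = \<phi> g (\<phi> h x)"
  using composition_rule by blast

lemma act_one: "x \<in> space M \<Longrightarrow> \<phi> \<one> x = x"
  by (metis id_eq_one restrict_apply')

lemma act_inv_cancel:
  "g \<in> carrier G \<Longrightarrow> x \<in> space M \<Longrightarrow> \<phi> (inv g) (\<phi> g x) = x"
  "g \<in> carrier G \<Longrightarrow> x \<in> space M \<Longrightarrow> \<phi> g (\<phi> (inv g) x) = x"
  by (metis act_mult act_one inv_closed l_inv r_inv)+

lemma act_commute:
  "g \<in> carrier G \<Longrightarrow> h \<in> carrier G \<Longrightarrow> x \<in> space M \<Longrightarrow> \<phi> g (\<phi> h x) = \<phi> h (\<phi> g x)"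
  by (metis act_mult m_comm)

lemma act_funpow:
  "g \<in> carrier G \<Longrightarrow> x \<in> space M \<Longrightarrow> (\<phi> g ^^ n) x = \<phi> (g [^] n) x"
  by (induction n) (auto simp: act_one act_mult[symmetric] m_comm)

lemma distr_act: "g \<in> carrier G \<Longrightarrow> distr M M (\<phi> g) = M"
  by (intro measure_eqI) (auto simp: emeasure_distr act_measurable act_preserves)

lemma AE_act:
  assumes "g \<in> carrier G" "AE x in M. P x"
  shows "AE x in M. P (\<phi> g x)"
  using assms(2) by (intro AE_distrD[OF act_measurable]) (simp_all only: assms(1) distr_act)

lemma AE_act_iff:
  assumes "g \<in> carrier G"
  shows "(AE x in M. P (\<phi> g x)) \<longleftrightarrow> (AE x in M. P x)"
proof
  assume "AE x in M. P (\<phi> g x)"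
  from AE_act[OF inv_closed[OF assms] this] have "AE x in M. P (\<phi> g (\<phi> (inv g) x))" .
  then show "AE x in M. P x"
    using AE_space by eventually_elim (simp add: act_inv_cancel assms)
qed (rule AE_act[OF assms])

lemma mem_translate_iff:
  assumes "g \<in> carrier G" "A \<subseteq> space M" "x \<in> space M"
  shows "x \<in> \<phi> g ` A \<longleftrightarrow> \<phi> (inv g) x \<in> A"
proof
  assume "x \<in> \<phi> g ` A"
  then show "\<phi> (inv g) x \<in> A"
    using assms(2) by (auto simp: act_inv_cancel(1)[OF assms(1)])
next
  assume "\<phi> (inv g) x \<in> A"
  then show "x \<in> \<phi> g ` A"
    using act_inv_cancel(2)[OF assms(1,3)] by (metis imageI)
qed

lemma translate_eq_vimage:
  assumes "g \<in> carrier G" "A \<subseteq> space M"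
  shows "\<phi> g ` A = \<phi> (inv g) -` A \<inter> space M"
proof -
  have "\<phi> g ` A \<subseteq> space M"
    using act_in_space[OF assms(1)] assms(2) by blast
  then show ?thesis
    using mem_translate_iff[OF assms] by auto
qed

lemma translate_sets:
  assumes "g \<in> carrier G" "A \<in> sets M"
  shows "\<phi> g ` A \<in> sets M"
  using assms sets.sets_into_space[OF assms(2)] act_measurable[of "inv g"]
  by (simp add: translate_eq_vimage measurable_sets)

text \<open>The set \<open>A\<close> is pulled back along \<open>a i\<close>, so the tiles are the translates of \<open>A\<close> by the inverses of the
  \<open>a i\<close>. Indexing by \<open>I\<close> keeps the number of tiles fixed when the group elements are raised to a
  power, even if distinct elements acquire equal powers.\<close>

definition tiles :: "'x set \<Rightarrow> 'i set \<Rightarrow> ('i \<Rightarrow> 'g) \<Rightarrow> bool"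
  where "tiles A I a \<longleftrightarrow> (AE x in M. (\<Sum>i\<in>I. indicator A (\<phi> (a i) x)) = (1::int))"

lemma tiles_cong: "(\<And>i. i \<in> I \<Longrightarrow> a i = b i) \<Longrightarrow> tiles A I a \<longleftrightarrow> tiles A I b"
  by (simp add: tiles_def)

text \<open>Let \<open>h\<close> be the multiplicity of the family \<open>b\<close>. Summing \<open>h\<close> over the shifts \<open>a\<close> and exchanging the two
  families gives \<open>card J\<close>, because \<open>a\<close> tiles. Hence the sum of \<open>h - 1\<close> over the shifts \<open>a\<close> vanishes, and
  if \<open>h - 1\<close> has constant sign then each summand vanishes. A single shift of \<open>h - 1\<close> that vanishes
  almost everywhere is enough, since the action preserves null sets.\<close>

lemma tiles_by_equal_card:
  assumes I: "finite I" "a \<in> I \<rightarrow> carrier G" "tiles A I a"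
    and J: "finite J" "b \<in> J \<rightarrow> carrier G" "card J = card I"
    and "(AE x in M. (\<Sum>j\<in>J. indicator A (\<phi> (b j) x)) \<ge> (1::int)) \<or>
      (AE x in M. (\<Sum>j\<in>J. indicator A (\<phi> (b j) x)) \<le> (1::int))"
  shows "tiles A J b"
proof (cases "I = {}")
  case True
  then show ?thesis
    using assms by (simp add: tiles_def)
next
  case False
  then obtain i0 where i0: "i0 \<in> I"
    by blast
  define h :: "'x \<Rightarrow> int" where "h x = (\<Sum>j\<in>J. indicator A (\<phi> (b j) x))" for x
  have "AE x in M. \<forall>j\<in>J. (\<Sum>i\<in>I. indicator A (\<phi> (a i) (\<phi> (b j) x))) = (1::int)"
    using J I(3) by (intro AE_finite_allI AE_act) (auto simp: tiles_def)
  then have sum_h: "AE x in M. (\<Sum>i\<in>I. h (\<phi> (a i) x)) = int (card I)"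
    using AE_space
  proof eventually_elim
    case (elim x)
    have "(\<Sum>i\<in>I. h (\<phi> (a i) x)) = (\<Sum>j\<in>J. \<Sum>i\<in>I. indicator A (\<phi> (b j) (\<phi> (a i) x)))"
      unfolding h_def by (rule sum.swap)
    also have "\<dots> = (\<Sum>j\<in>J. \<Sum>i\<in>I. indicator A (\<phi> (a i) (\<phi> (b j) x)))"
      using I J elim(2) by (intro sum.cong refl arg_cong[of _ _ "indicator A"] act_commute) auto
    finally show ?case
      using elim(1) J(3) by simp
  qed
  have "AE x in M. h (\<phi> (a i0) x) = 1"
    using assms(7) unfolding h_def[symmetric]
  proof
    assume "AE x in M. h x \<ge> 1"
    then have "AE x in M. \<forall>i\<in>I. h (\<phi> (a i) x) \<ge> 1"
      using I by (intro AE_finite_allI AE_act) auto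
    then show ?thesis
      using sum_h
    proof eventually_elim
      case (elim x)
      then have "(\<Sum>i\<in>I. h (\<phi> (a i) x) - 1) = 0"
        by (simp add: sum_subtractf)
      then show ?case
        using elim(1) I(1) i0 by (subst (asm) sum_nonneg_eq_0_iff) auto
    qed
  next
    assume "AE x in M. h x \<le> 1"
    then have "AE x in M. \<forall>i\<in>I. h (\<phi> (a i) x) \<le> 1"
      using I by (intro AE_finite_allI AE_act) auto
    then show ?thesis
      using sum_h
    proof eventually_elim
      case (elim x)
      then have "(\<Sum>i\<in>I. 1 - h (\<phi> (a i) x)) = 0"
        by (simp add: sum_subtractf)
      then show ?case
        using elim(1) I(1) i0 by (subst (asm) sum_nonneg_eq_0_iff) auto
    qed
  qed
  then show ?thesis
    unfolding tiles_def h_def[symmetric]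
    using AE_act_iff[of "a i0" "\<lambda>x. h x = 1"] funcset_mem[OF I(2) i0] by simp
qed

text \<open>By Frobenius and Fermat's little theorem the multiplicity of the \<open>p\<close>-th powers is congruent to \<open>1\<close>
  modulo \<open>p\<close>, so it cannot be \<open>0\<close> and the \<open>p\<close>-th powers cover.\<close>

lemma tiles_pow_prime:
  assumes I: "finite I" "a \<in> I \<rightarrow> carrier G" "tiles A I a"
    and p: "prime p" "\<not> p dvd card I"
  shows "tiles A I (\<lambda>i. a i [^] p)"
proof (rule tiles_by_equal_card[OF I I(1) _ refl])
  \<comment> \<open>Outside \<open>space M\<close> the action has junk values; the identity there makes the maps commute everywhere.\<close>
  define T where "T i x = (if x \<in> space M then \<phi> (a i) x else x)" for i x
  have T_comm: "T j (T i x) = T i (T j x)" if "i \<in> I" "j \<in> I" for i j x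
    using I(2) that by (auto simp: T_def act_in_space Pi_iff intro!: act_commute)
  have T_pow: "(T i ^^ n) x = \<phi> (a i [^] n) x" if "i \<in> I" "x \<in> space M" for i n x
  proof -
    have "(T i ^^ n) x = (\<phi> (a i) ^^ n) x \<and> (T i ^^ n) x \<in> space M"
      using I(2) that by (induction n) (auto simp: T_def act_in_space Pi_iff)
    then show ?thesis
      using I(2) that by (simp add: act_funpow Pi_iff)
  qed
  have const: "AE x in M. (shift_sum T I ^^ Suc n) (indicator A) x = int (card I) ^ n" for n
  proof (induction n)
    case 0
    show ?case
      using I(3)[unfolded tiles_def] AE_space
      by eventually_elim (simp add: shift_sum_def T_def)
  next
    case (Suc n)
    let ?v = "(shift_sum T I ^^ Suc n) (indicator A)"
    have "AE x in M. \<forall>i\<in>I. ?v (\<phi> (a i) x) = int (card I) ^ n"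
      using I Suc.IH by (intro AE_finite_allI AE_act) auto
    then show ?case
      using AE_space
    proof eventually_elim
      case (elim x)
      have "(shift_sum T I ^^ Suc (Suc n)) (indicator A) x = (\<Sum>i\<in>I. ?v (T i x))"
        by (simp only: funpow.simps(2)[of "Suc n"] o_apply shift_sum_def)
      also have "\<dots> = (\<Sum>i\<in>I. int (card I) ^ n)"
        using elim by (intro sum.cong) (auto simp only: T_def if_True)
      finally show ?case
        by simp
    qed
  qed
  have fermat: "[int (card I) ^ (p - 1) = 1] (mod int p)"
    using fermat_theorem[OF p] by (metis cong_int_iff of_nat_1 of_nat_power)
  have "AE x in M. (\<Sum>i\<in>I. indicator A (\<phi> (a i [^] p) x)) \<ge> (1::int)"
    using const[of "p - 1"] AE_space
  proof eventually_elim
    case (elim x)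
    let ?h = "\<Sum>i\<in>I. indicator A (\<phi> (a i [^] p) x) :: int"
    have "[(shift_sum T I ^^ p) (indicator A) x = (\<Sum>i\<in>I. indicator A ((T i ^^ p) x))] (mod int p)"
      using I(1) p(1) T_comm by (rule shift_sum_frobenius)
    then have "[int (card I) ^ (p - 1) = ?h] (mod int p)"
      using elim prime_gt_0_nat[OF p(1)] by (simp add: T_pow)
    then have "[?h = 1] (mod int p)"
      using fermat by (metis cong_sym cong_trans)
    then have "?h \<noteq> 0"
      using prime_gt_1_nat[OF p(1)] by (auto simp: cong_def)
    moreover have "?h \<ge> 0"
      by (intro sum_nonneg) simp
    ultimately show ?case
      by simp
  qed
  then show "(AE x in M. (\<Sum>i\<in>I. indicator A (\<phi> (a i [^] p) x)) \<ge> (1::int)) \<or>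
      (AE x in M. (\<Sum>i\<in>I. indicator A (\<phi> (a i [^] p) x)) \<le> (1::int))"
    by blast
qed (use I in auto)

lemma indicator_sum_le_1_iff:
  assumes "finite I"
  shows "(\<Sum>i\<in>I. indicator A (f i)) \<le> (1::int) \<longleftrightarrow>
    (\<forall>i\<in>I. \<forall>j\<in>I. f i \<in> A \<and> f j \<in> A \<longrightarrow> i = j)"
proof -
  have "(\<Sum>i\<in>I. indicator A (f i)) = int (card {i\<in>I. f i \<in> A})"
    using assms by (simp add: indicator_def sum.If_cases Int_def)
  then have "(\<Sum>i\<in>I. indicator A (f i)) \<le> (1::int) \<longleftrightarrow> card {i\<in>I. f i \<in> A} \<le> Suc 0"
    by simp
  also have "\<dots> \<longleftrightarrow> (\<forall>i\<in>I. \<forall>j\<in>I. f i \<in> A \<and> f j \<in> A \<longrightarrow> i = j)"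
    using assms by (subst card_le_Suc0_iff_eq) auto
  finally show ?thesis .
qed

text \<open>If \<open>x\<close> lies in two tiles of the inverted family, with indices \<open>i\<close> and \<open>j\<close>, then the shift of \<open>x\<close> by
  \<open>inv (a i) \<otimes> inv (a j)\<close> lies in the tiles \<open>j\<close> and \<open>i\<close> of the original family. So the inverted
  family is a packing.\<close>

lemma tiles_inv:
  assumes I: "finite I" "a \<in> I \<rightarrow> carrier G" "tiles A I a"
  shows "tiles A I (\<lambda>i. inv (a i))"
proof (rule tiles_by_equal_card[OF I I(1) _ refl])
  have packing: "AE x in M. \<phi> (a i) x \<in> A \<and> \<phi> (a j) x \<in> A \<longrightarrow> i = j" if "i \<in> I" "j \<in> I" for i j
    using I(3)[unfolded tiles_def]
  proof eventually_elim
    case (elim x)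
    then have "(\<Sum>i\<in>I. indicator A (\<phi> (a i) x)) \<le> (1::int)"
      by simp
    then show ?case
      using that unfolding indicator_sum_le_1_iff[OF I(1)] by blast
  qed
  \<comment> \<open>Cancelling \<open>a i\<close>, respectively \<open>a j\<close>, leaves the inverted tiles \<open>j\<close> and \<open>i\<close>.\<close>
  have "AE x in M. \<phi> (a i) (\<phi> (inv (a i) \<otimes> inv (a j)) x) \<in> A \<and>
      \<phi> (a j) (\<phi> (inv (a i) \<otimes> inv (a j)) x) \<in> A \<longrightarrow> i = j" if "i \<in> I" "j \<in> I" for i j
    by (rule AE_act[OF _ packing[OF that]]) (use that funcset_mem[OF I(2)] in simp)
  then have "AE x in M. \<forall>i\<in>I. \<forall>j\<in>I. \<phi> (a i) (\<phi> (inv (a i) \<otimes> inv (a j)) x) \<in> A \<and>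
      \<phi> (a j) (\<phi> (inv (a i) \<otimes> inv (a j)) x) \<in> A \<longrightarrow> i = j"
    using I(1) by (intro AE_finite_allI) auto
  then have "AE x in M. (\<Sum>i\<in>I. indicator A (\<phi> (inv (a i)) x)) \<le> (1::int)"
    using AE_space
  proof eventually_elim
    case (elim x)
    have cancel: "\<phi> (a i) (\<phi> (inv (a i) \<otimes> inv (a j)) x) = \<phi> (inv (a j)) x"
        "\<phi> (a j) (\<phi> (inv (a i) \<otimes> inv (a j)) x) = \<phi> (inv (a i)) x" if "i \<in> I" "j \<in> I" for i j
    proof -
      have *: "a i \<in> carrier G" "a j \<in> carrier G"
        using I(2) that by auto
      show "\<phi> (a i) (\<phi> (inv (a i) \<otimes> inv (a j)) x) = \<phi> (inv (a j)) x"
        using * elim(2) by (simp add: act_mult act_inv_cancel act_in_space)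
      show "\<phi> (a j) (\<phi> (inv (a i) \<otimes> inv (a j)) x) = \<phi> (inv (a i)) x"
        using * elim(2) by (simp add: m_comm[of "inv (a i)"] act_mult act_inv_cancel act_in_space)
    qed
    show ?case
      unfolding indicator_sum_le_1_iff[OF I(1)] using elim(1) cancel by metis
  qed
  then show "(AE x in M. (\<Sum>i\<in>I. indicator A (\<phi> (inv (a i)) x)) \<ge> (1::int)) \<or>
      (AE x in M. (\<Sum>i\<in>I. indicator A (\<phi> (inv (a i)) x)) \<le> (1::int))"
    by blast
qed (use I in auto)

lemma tiles_pow:
  assumes I: "finite I" "a \<in> I \<rightarrow> carrier G" "tiles A I a"
    and n: "coprime n (card I)"
  shows "tiles A I (\<lambda>i. a i [^] (n::nat))"
  using n
proof (induction n rule: prime_divisors_induct)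
  \<comment> \<open>The exponent \<open>0\<close> is coprime to \<open>card I\<close> only for a single tile.\<close>
  case zero
  then have "card I = 1"
    by simp
  show ?case
  proof (rule tiles_by_equal_card[OF I I(1) _ refl])
    have "AE x in M. (\<Sum>i\<in>I. indicator A (\<phi> (a i [^] (0::nat)) x)) \<le> (1::int)"
      using \<open>card I = 1\<close> by (auto simp: indicator_def)
    then show "(AE x in M. (\<Sum>i\<in>I. indicator A (\<phi> (a i [^] (0::nat)) x)) \<ge> (1::int)) \<or>
        (AE x in M. (\<Sum>i\<in>I. indicator A (\<phi> (a i [^] (0::nat)) x)) \<le> (1::int))"
      by blast
  qed auto
next
  case (unit n)
  then show ?case
    using I tiles_cong[of I "\<lambda>i. a i [^] n" a] by (simp add: Pi_iff)
next
  case (factor p n)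
  have "\<not> p dvd card I"
    using factor.prems factor.hyps
    by (metis coprime_common_divisor dvd_triv_left not_prime_unit)
  then have "tiles A I (\<lambda>i. (a i [^] n) [^] p)"
    using factor.IH factor.prems factor.hyps I
    by (intro tiles_pow_prime[where p = p and a = "\<lambda>i. a i [^] n"]) auto
  then show ?case
    using I(2) tiles_cong[of I "\<lambda>i. (a i [^] n) [^] p" "\<lambda>i. a i [^] (p * n)"]
    by (simp add: nat_pow_pow Pi_iff mult.commute)
qed

lemma tiles_int_pow:
  assumes I: "finite I" "a \<in> I \<rightarrow> carrier G" "tiles A I a"
    and r: "coprime r (int (card I))"
  shows "tiles A I (\<lambda>i. a i [^] (r::int))"
proof (cases r rule: int_cases2)
  case (nonneg n)
  then show ?thesis
    using I r tiles_pow[of I a A n] by (simp add: int_pow_int)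
next
  case (nonpos n)
  then have "tiles A I (\<lambda>i. inv (a i [^] n))"
    using I r by (intro tiles_inv tiles_pow) auto
  then show ?thesis
    using I(2) nonpos tiles_cong[of I "\<lambda>i. inv (a i [^] n)" "\<lambda>i. a i [^] r"]
    by (simp add: int_pow_neg_int Pi_iff)
qed

section \<open>The dilation lemma\<close>

lemma ae_tiling_imp_tiles:
  assumes F: "finite F" "F \<subseteq> carrier G" and A: "A \<in> sets M" and tiling: "ae_tiling M \<phi> F A"
  shows "tiles A F (\<lambda>f. inv f)"
proof -
  have mem: "x \<in> \<phi> f ` A \<longleftrightarrow> \<phi> (inv f) x \<in> A" if "f \<in> F" "x \<in> space M" for f x
    using F(2) that sets.sets_into_space[OF A] by (intro mem_translate_iff) auto
  have "AE x in M. x \<notin> \<phi> f ` A \<inter> \<phi> g ` A" if "f \<in> F" "g \<in> F" "f \<noteq> g" for f g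
    using tiling that by (intro AE_not_in) (simp add: ae_tiling_def)
  then have "AE x in M. f \<noteq> g \<longrightarrow> x \<notin> \<phi> f ` A \<inter> \<phi> g ` A" if "f \<in> F" "g \<in> F" for f g
    using that by (cases "f = g") auto
  then have "AE x in M. \<forall>f\<in>F. \<forall>g\<in>F. f \<noteq> g \<longrightarrow> x \<notin> \<phi> f ` A \<inter> \<phi> g ` A"
    using F(1) by (intro AE_finite_allI) auto
  moreover have "AE x in M. x \<notin> space M - (\<Union>f\<in>F. \<phi> f ` A)"
    using tiling by (intro AE_not_in) (simp add: ae_tiling_def)
  ultimately show ?thesis
    unfolding tiles_def using AE_space
  proof eventually_elim
    case (elim x)
    have "(\<Sum>f\<in>F. indicator A (\<phi> (inv f) x)) \<le> (1::int)"
      unfolding indicator_sum_le_1_iff[OF F(1)] using elim mem by auto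
    moreover obtain f where f: "f \<in> F" "\<phi> (inv f) x \<in> A"
      using elim mem by auto
    then have "(1::int) \<le> (\<Sum>f\<in>F. indicator A (\<phi> (inv f) x))"
      using member_le_sum[of f F "\<lambda>f. indicator A (\<phi> (inv f) x) :: int"] F(1) by simp
    ultimately show ?case
      by simp
  qed
qed

text \<open>A point in two distinct translates from the set \<open>a ` I\<close> is counted at least twice by the family, so
  the statement for sets follows even if \<open>a\<close> is not injective.\<close>

lemma ae_tiling_image:
  assumes I: "finite I" "a \<in> I \<rightarrow> carrier G" and A: "A \<in> sets M"
    and tiles: "tiles A I (\<lambda>i. inv (a i))"
  shows "ae_tiling M \<phi> (a ` I) A"
proof -
  have mem: "x \<in> \<phi> (a i) ` A \<longleftrightarrow> \<phi> (inv (a i)) x \<in> A" if "i \<in> I" "x \<in> space M" for i x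
    using I(2) that sets.sets_into_space[OF A] by (intro mem_translate_iff) auto
  have sets: "\<phi> (a i) ` A \<in> sets M" if "i \<in> I" for i
    using I(2) A that by (intro translate_sets) auto
  show ?thesis
    unfolding ae_tiling_def
  proof (intro conjI ballI impI)
    fix f g
    assume "f \<in> a ` I" "g \<in> a ` I" "f \<noteq> g"
    then obtain i j where ij: "i \<in> I" "j \<in> I" "f = a i" "g = a j" "i \<noteq> j"
      by auto
    have "AE x in M. x \<notin> \<phi> f ` A \<inter> \<phi> g ` A"
      using tiles[unfolded tiles_def] AE_space
    proof eventually_elim
      case (elim x)
      then have "\<forall>i\<in>I. \<forall>j\<in>I. \<phi> (inv (a i)) x \<in> A \<and> \<phi> (inv (a j)) x \<in> A \<longrightarrow> i = j"
        by (simp flip: indicator_sum_le_1_iff[OF I(1)])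
      then show ?case
        using ij elim(2) by (auto simp: mem)
    qed
    then show "\<phi> f ` A \<inter> \<phi> g ` A \<in> null_sets M"
      using ij sets by (subst AE_iff_null_sets) auto
  next
    have "AE x in M. x \<notin> space M - (\<Union>f\<in>a ` I. \<phi> f ` A)"
      using tiles[unfolded tiles_def] AE_space
    proof eventually_elim
      case (elim x)
      have "\<exists>i\<in>I. \<phi> (inv (a i)) x \<in> A"
      proof (rule ccontr)
        assume "\<not> ?thesis"
        then have "(\<Sum>i\<in>I. indicator A (\<phi> (inv (a i)) x)) = (0::int)"
          by (intro sum.neutral) auto
        then show False
          using elim(1) by simp
      qed
      then show ?case
        using elim(2) by (auto simp: mem)
    qed
    then show "space M - (\<Union>f\<in>a ` I. \<phi> f ` A) \<in> null_sets M"
      using I(1) sets by (subst AE_iff_null_sets) auto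
  qed
qed

lemma dilation:
  assumes "finite F" "F \<subseteq> carrier G" "A \<in> sets M" "ae_tiling M \<phi> F A"
    and "coprime r (int (card F))"
  shows "ae_tiling M \<phi> (set_int_pow G F r) A"
  unfolding set_int_pow_def
proof (rule ae_tiling_image)
  have "tiles A F (\<lambda>f. (inv f) [^] r)"
    using assms by (intro tiles_int_pow ae_tiling_imp_tiles) auto
  then show "tiles A F (\<lambda>f. inv (f [^] r))"
    using assms(2) tiles_cong[of F "\<lambda>f. (inv f) [^] r" "\<lambda>f. inv (f [^] r)" A]
    by (simp add: int_pow_inv subset_iff)
qed (use assms in auto)

end

section \<open>Upper Birkhoff averages and the pointwise ergodic theorem\<close>

definition birkhoff_average :: "('x \<Rightarrow> 'x) \<Rightarrow> ('x \<Rightarrow> real) \<Rightarrow> nat \<Rightarrow> 'x \<Rightarrow> real"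
  where "birkhoff_average T u n x = (\<Sum>k<n. u ((T ^^ k) x)) / real n"

text \<open>The limit superior is taken in the extended reals, where it exists and is measurable; for \<open>u\<close> with
  values in \<open>[0,1]\<close> it is finite.\<close>

definition upper_average :: "('x \<Rightarrow> 'x) \<Rightarrow> ('x \<Rightarrow> real) \<Rightarrow> 'x \<Rightarrow> real"
  where "upper_average T u x = real_of_ereal (limsup (\<lambda>n. ereal (birkhoff_average T u n x)))"

context
  fixes T :: "'x \<Rightarrow> 'x" and u :: "'x \<Rightarrow> real"
  assumes u_range: "u x \<in> {0..1}"
begin

lemma birkhoff_average_range: "birkhoff_average T u n x \<in> {0..1}"
proof -
  have "(\<Sum>k<n. u ((T ^^ k) x)) \<le> (\<Sum>k<n. 1)" "0 \<le> (\<Sum>k<n. u ((T ^^ k) x))"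
    using u_range by (intro sum_mono sum_nonneg; force)+
  then show ?thesis
    by (simp add: birkhoff_average_def divide_simps)
qed

lemma ereal_upper_average:
  "ereal (upper_average T u x) = limsup (\<lambda>n. ereal (birkhoff_average T u n x))"
  and upper_average_range: "upper_average T u x \<in> {0..1}"
proof -
  let ?l = "limsup (\<lambda>n. ereal (birkhoff_average T u n x))"
  have l: "0 \<le> ?l" "?l \<le> 1"
    using birkhoff_average_range by (auto intro!: Limsup_bounded le_Limsup always_eventually)
  then show *: "ereal (upper_average T u x) = ?l"
    unfolding upper_average_def by (intro ereal_real') auto
  show "upper_average T u x \<in> {0..1}"
    using l unfolding *[symmetric] by simp
qed

lemma eventually_birkhoff_average_less:
  assumes "upper_average T u x < c"
  shows "\<forall>\<^sub>F n in sequentially. birkhoff_average T u n x < c"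
  using assms Limsup_lessD[of sequentially "\<lambda>n. ereal (birkhoff_average T u n x)" "ereal c"]
  by (simp flip: ereal_upper_average)

lemma exists_birkhoff_average_greater:
  assumes "c < upper_average T u x"
  shows "\<exists>n\<ge>1. c < birkhoff_average T u n x"
proof (rule ccontr)
  assume "\<not> ?thesis"
  then have "\<forall>\<^sub>F n in sequentially. ereal (birkhoff_average T u n x) \<le> ereal c"
    by (intro eventually_sequentiallyI[of 1]) (auto simp: not_less)
  then have "limsup (\<lambda>n. ereal (birkhoff_average T u n x)) \<le> ereal c"
    by (rule Limsup_bounded)
  then show False
    using assms by (simp flip: ereal_upper_average)
qed

text \<open>Passing from \<open>x\<close> to \<open>T x\<close> replaces one term of the sum, which changes the \<open>n\<close>-th average by at most
  \<open>1/n\<close>.\<close>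

lemma upper_average_invariant: "upper_average T u (T x) = upper_average T u x"
proof -
  let ?d = "\<lambda>n. (u ((T ^^ n) x) - u x) / real n"
  have "birkhoff_average T u n (T x) = ?d n + birkhoff_average T u n x" for n
  proof -
    have "(\<Sum>k<n. u ((T ^^ k) (T x))) + u x = (\<Sum>k<n. u ((T ^^ k) x)) + u ((T ^^ n) x)"
      using sum.lessThan_Suc_shift[of "\<lambda>k. u ((T ^^ k) x)" n]
      by (simp add: funpow_Suc_right del: funpow.simps)
    then show ?thesis
      by (simp add: birkhoff_average_def diff_divide_distrib add_divide_distrib algebra_simps)
        (simp flip: add_divide_distrib)
  qed
  moreover have "?d \<longlonglongrightarrow> 0"
  proof (rule Lim_null_comparison)
    show "\<forall>\<^sub>F n in sequentially. norm (?d n) \<le> 1 / real n"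
    proof (intro always_eventually allI)
      fix n
      have "\<bar>u ((T ^^ n) x) - u x\<bar> \<le> 1"
        using u_range[of "(T ^^ n) x"] u_range[of x] by auto
      then show "norm (?d n) \<le> 1 / real n"
        by (simp add: divide_right_mono)
    qed
  qed (rule lim_1_over_n)
  ultimately have "limsup (\<lambda>n. ereal (birkhoff_average T u n (T x))) =
      limsup (\<lambda>n. ereal (birkhoff_average T u n x))"
    using ereal_limsup_lim_add[of "\<lambda>n. ereal (?d n)" 0 "\<lambda>n. ereal (birkhoff_average T u n x)"]
    by (simp add: zero_ereal_def)
  then show ?thesis
    by (simp add: upper_average_def)
qed

lemma upper_average_fixed:
  assumes "\<And>k. u ((T ^^ k) x) = u x"
  shows "upper_average T u x = u x"
proof -
  have "\<forall>\<^sub>F n in sequentially. ereal (birkhoff_average T u n x) = ereal (u x)"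
    using eventually_gt_at_top[of "0::nat"]
    by eventually_elim (simp add: birkhoff_average_def assms)
  then have "limsup (\<lambda>n. ereal (birkhoff_average T u n x)) = limsup (\<lambda>n. ereal (u x))"
    by (rule Limsup_eq)
  then show ?thesis
    by (simp add: upper_average_def Limsup_const)
qed

context
  fixes M :: "'x measure"
  assumes T_measurable [measurable]: "T \<in> M \<rightarrow>\<^sub>M M"
    and u_measurable [measurable]: "u \<in> borel_measurable M"
begin

lemma birkhoff_average_measurable [measurable]: "birkhoff_average T u n \<in> borel_measurable M"
  unfolding birkhoff_average_def[abs_def] by measurable

lemma upper_average_measurable [measurable]: "upper_average T u \<in> borel_measurable M"
  unfolding upper_average_def[abs_def] by measurable

text \<open>Every point starts an orbit block of length at most \<open>m\<close> on which the average of \<open>v\<close> nearly reaches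
  the upper average, so the first \<open>L\<close> steps can be cut greedily into such blocks. The upper average is constant along the orbit, so the blocks add up, and only the last incomplete
  block, of length less than \<open>m\<close>, is lost.\<close>

lemma sum_ge_upper_average:
  fixes v :: "'x \<Rightarrow> real"
  assumes "0 < e"
    and block: "\<And>x. \<exists>n\<in>{1..m}. real n * (upper_average T u x - e) \<le> (\<Sum>k<n. v ((T ^^ k) x))"
    and "\<And>x. 0 \<le> v x"
  shows "(real L - real m) * upper_average T u x - real L * e \<le> (\<Sum>k<L. v ((T ^^ k) x))"
proof (induction L arbitrary: x rule: less_induct)
  case (less L)
  have bounds: "0 \<le> upper_average T u x"
    using upper_average_range[of x] by simp
  show ?case
  proof (cases "L < m")
    case True
    then have "(real L - real m) * upper_average T u x \<le> 0"
      using bounds by (intro mult_nonpos_nonneg) auto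
    then have "(real L - real m) * upper_average T u x - real L * e \<le> 0"
      using \<open>0 < e\<close> by (smt (verit) mult_nonneg_nonneg of_nat_0_le_iff)
    also have "0 \<le> (\<Sum>k<L. v ((T ^^ k) x))"
      using assms(3) by (intro sum_nonneg) auto
    finally show ?thesis .
  next
    case False
    obtain n where n: "1 \<le> n" "n \<le> m"
        "real n * (upper_average T u x - e) \<le> (\<Sum>k<n. v ((T ^^ k) x))"
      using block[of x] by auto
    have inv: "upper_average T u ((T ^^ n) x) = upper_average T u x"
      by (induction n) (auto simp: upper_average_invariant)
    have "(real (L - n) - real m) * upper_average T u x - real (L - n) * e
        \<le> (\<Sum>k<L - n. v ((T ^^ k) ((T ^^ n) x)))"
      using less.IH[of "L - n" "(T ^^ n) x"] n False by (simp add: inv)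
    moreover have "(\<Sum>k<L. v ((T ^^ k) x)) =
        (\<Sum>k<n. v ((T ^^ k) x)) + (\<Sum>k<L - n. v ((T ^^ k) ((T ^^ n) x)))"
    proof -
      have "(\<Sum>k<n + (L - n). v ((T ^^ k) x)) =
          (\<Sum>k<n. v ((T ^^ k) x)) + (\<Sum>k<L - n. v ((T ^^ (k + n)) x))"
        unfolding lessThan_atLeast0
        by (subst sum.atLeastLessThan_concat[symmetric, of 0 n])
          (simp_all add: sum.atLeastLessThan_shift_0[of _ n] add.commute)
      then show ?thesis
        using n False by (simp add: funpow_add)
    qed
    moreover have "real (L - n) = real L - real n"
      using n False by auto
    ultimately show ?thesis
      using n(3) by (simp add: algebra_simps)
  qed
qed

text \<open>The argument of Katznelson and Weiss. Every point of a set \<open>G m\<close> with small complement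
  sees within \<open>m\<close> steps an average of \<open>u\<close> close to its upper average. Replacing \<open>u\<close> by \<open>1\<close> off
  \<open>G m\<close> costs little in the integral and makes blocks of length \<open>1\<close> good there. Integrating the
  bound on long orbit segments and dividing by their length \<open>L\<close> gives the claim as \<open>L\<close> grows.\<close>

lemma integral_upper_average_le:
  assumes "finite_measure M" and preserving: "distr M M T = M"
  shows "(\<integral>x. upper_average T u x \<partial>M) \<le> (\<integral>x. u x \<partial>M)"
proof (rule field_le_epsilon)
  interpret finite_measure M by fact
  fix d :: real
  assume "0 < d"
  \<comment> \<open>One \<open>e\<close> pays for changing \<open>u\<close> off \<open>G m\<close>, and \<open>e * measure M (space M)\<close> for the error in the blocks.\<close>
  define e where "e = d / (1 + measure M (space M))"
  have e: "0 < e" "e + e * measure M (space M) = d"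
    using \<open>0 < d\<close> unfolding e_def
    by (auto simp: add_pos_nonneg simp flip: distrib_left) (simp add: field_simps add_nonneg_eq_0_iff)
  let ?U = "upper_average T u"
  define G where "G m = {x\<in>space M. \<exists>n\<in>{1..m}. ?U x - e < birkhoff_average T u n x}" for m
  have G_sets [measurable]: "G m \<in> sets M" for m
    unfolding G_def by measurable
  have "(\<lambda>m. measure M (space M - G m)) \<longlonglongrightarrow> measure M (\<Inter>m. space M - G m)"
    by (intro finite_Lim_measure_decseq) (auto simp: decseq_def G_def)
  moreover have "(\<Inter>m. space M - G m) = {}"
    using exists_birkhoff_average_greater[of "?U x - e" x for x] e(1) by (fastforce simp: G_def)
  ultimately have "(\<lambda>m. measure M (space M - G m)) \<longlonglongrightarrow> 0"
    by (simp only: measure_empty)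
  then have "\<forall>\<^sub>F m in sequentially. measure M (space M - G m) < e"
    using e(1) by (rule order_tendstoD(2))
  then obtain m0 where m0: "\<And>m. m \<ge> m0 \<Longrightarrow> measure M (space M - G m) < e"
    by (auto simp: eventually_sequentially)
  define m where "m = Suc m0"
  have m: "measure M (space M - G m) < e" "1 \<le> m"
    using m0 by (auto simp: m_def)
  define v where "v x = (if x \<in> G m then u x else 1)" for x
  have v_range: "0 \<le> v x" "v x \<le> 1" for x
    using u_range[of x] by (auto simp: v_def)
  have [measurable]: "v \<in> borel_measurable M"
    unfolding v_def[abs_def] by measurable
  have [measurable]: "(T ^^ k) \<in> M \<rightarrow>\<^sub>M M" for k
    by measurable
  have distr_pow: "distr M M (T ^^ k) = M" for k
  proof (induction k)
    case (Suc k)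
    have "distr M M (T ^^ Suc k) = distr (distr M M (T ^^ k)) M T"
      by (subst distr_distr) auto
    also have "\<dots> = M"
      by (simp only: Suc.IH preserving)
    finally show ?case .
  qed (simp add: distr_id id_def)
  have block: "\<exists>n\<in>{1..m}. real n * (?U x - e) \<le> (\<Sum>k<n. v ((T ^^ k) x))" for x
  proof (cases "x \<in> G m")
    case True
    then obtain n where n: "n \<in> {1..m}" "?U x - e < birkhoff_average T u n x"
      by (auto simp: G_def)
    then have "real n * (?U x - e) \<le> (\<Sum>k<n. u ((T ^^ k) x))"
      by (auto simp: birkhoff_average_def field_simps)
    also have "\<dots> \<le> (\<Sum>k<n. v ((T ^^ k) x))"
      using u_range by (intro sum_mono) (auto simp: v_def)
    finally show ?thesis
      using n(1) by blast
  next
    case False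
    then show ?thesis
      using m(2) upper_average_range[of x] e(1) by (intro bexI[of _ 1]) (auto simp: v_def)
  qed
  have int: "integrable M ?U" "integrable M v" "integrable M u" "integrable M (\<lambda>x. v ((T ^^ k) x))" for k
    using upper_average_range u_range v_range by (auto intro!: integrable_const_bound[of _ 1] AE_I2)
  have int_v: "(\<integral>x. v x \<partial>M) \<le> (\<integral>x. u x \<partial>M) + e"
  proof -
    have int_ind: "integrable M (indicator (space M - G m) :: 'x \<Rightarrow> real)"
      by (intro integrable_const_bound[of _ 1]) (auto simp: indicator_def)
    have "v x \<le> u x + indicator (space M - G m) x" if "x \<in> space M" for x
      using u_range[of x] that by (simp add: v_def indicator_def)
    then have "(\<integral>x. v x \<partial>M) \<le> (\<integral>x. u x + indicator (space M - G m) x \<partial>M)"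
      using int int_ind by (intro integral_mono Bochner_Integration.integrable_add)
    also have "\<dots> = (\<integral>x. u x \<partial>M) + measure M (space M - G m)"
      using int int_ind by (subst Bochner_Integration.integral_add) auto
    finally show ?thesis
      using m by simp
  qed
  have key: "real L * ((\<integral>x. ?U x \<partial>M) - (\<integral>x. u x \<partial>M) - d) \<le> real m * (\<integral>x. ?U x \<partial>M)" for L
  proof -
    have "(real L - real m) * (\<integral>x. ?U x \<partial>M) - real L * e * measure M (space M) =
        (\<integral>x. (real L - real m) * ?U x - real L * e \<partial>M)"
      using int by simp
    also have "\<dots> \<le> (\<integral>x. (\<Sum>k<L. v ((T ^^ k) x)) \<partial>M)"
      using int sum_ge_upper_average[OF e(1) block v_range(1)] by (intro integral_mono) auto
    also have "\<dots> = (\<Sum>k<L. \<integral>x. v ((T ^^ k) x) \<partial>M)"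
      using int by simp
    also have "\<dots> = (\<Sum>k<L. \<integral>x. v x \<partial>M)"
      using integral_distr[of "T ^^ k" M M v for k] by (simp add: distr_pow)
    also have "\<dots> \<le> real L * ((\<integral>x. u x \<partial>M) + e)"
      using int_v by (simp add: mult_left_mono)
    finally show ?thesis
      unfolding e(2)[symmetric] by (simp add: algebra_simps)
  qed
  show "(\<integral>x. ?U x \<partial>M) \<le> (\<integral>x. u x \<partial>M) + d"
  proof (rule ccontr)
    assume "\<not> ?thesis"
    then obtain L where "real m * (\<integral>x. ?U x \<partial>M) < real L * ((\<integral>x. ?U x \<partial>M) - (\<integral>x. u x \<partial>M) - d)"
      using reals_Archimedean3[of "(\<integral>x. ?U x \<partial>M) - (\<integral>x. u x \<partial>M) - d"] by auto
    then show False
      using key[of L] by simp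
  qed
qed

end
end

section \<open>The structure theorem\<close>

text \<open>The Birkhoff averages of a given length sum to \<open>1\<close>. If the upper averages summed to less, then
  sharing the deficit among them would bound all averages of some large length strictly from above
  by numbers with sum \<open>1\<close>.\<close>

lemma sum_upper_average_ge_1:
  assumes "finite F" "F \<noteq> {}" and u_range: "\<And>f x. u f x \<in> {0..1}"
    and partition: "\<And>k. (\<Sum>f\<in>F. u f ((T f ^^ k) x)) = 1"
  shows "1 \<le> (\<Sum>f\<in>F. upper_average (T f) (u f) x)"
proof (rule ccontr)
  let ?S = "\<Sum>f\<in>F. upper_average (T f) (u f) x"
  assume "\<not> 1 \<le> ?S"
  define d where "d = (1 - ?S) / real (card F)"
  have d: "0 < d" "real (card F) * d = 1 - ?S"
    using assms(1,2) \<open>\<not> 1 \<le> ?S\<close> by (auto simp: d_def card_gt_0_iff)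
  have "\<forall>\<^sub>F n in sequentially.
      birkhoff_average (T f) (u f) n x < upper_average (T f) (u f) x + d" for f
    by (rule eventually_birkhoff_average_less[OF u_range[of f]]) (use d(1) in simp)
  then have "\<forall>\<^sub>F n in sequentially. \<forall>f\<in>F.
      birkhoff_average (T f) (u f) n x < upper_average (T f) (u f) x + d"
    using assms(1) by (intro eventually_ball_finite) auto
  then have "\<forall>\<^sub>F n in sequentially. n > 0 \<and> (\<forall>f\<in>F.
      birkhoff_average (T f) (u f) n x < upper_average (T f) (u f) x + d)"
    using eventually_gt_at_top[of "0::nat"] by eventually_elim auto
  then obtain n where n: "n > 0"
      "\<And>f. f \<in> F \<Longrightarrow> birkhoff_average (T f) (u f) n x < upper_average (T f) (u f) x + d"
    by (auto dest!: eventually_happens)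
  have "(\<Sum>f\<in>F. birkhoff_average (T f) (u f) n x) = (\<Sum>f\<in>F. \<Sum>k<n. u f ((T f ^^ k) x)) / real n"
    by (simp add: birkhoff_average_def sum_divide_distrib)
  also have "(\<Sum>f\<in>F. \<Sum>k<n. u f ((T f ^^ k) x)) = (\<Sum>k<n. \<Sum>f\<in>F. u f ((T f ^^ k) x))"
    by (rule sum.swap)
  also have "\<dots> / real n = 1"
    using n(1) by (simp add: partition)
  finally have "1 = (\<Sum>f\<in>F. birkhoff_average (T f) (u f) n x)"
    by simp
  also have "\<dots> < (\<Sum>f\<in>F. upper_average (T f) (u f) x + d)"
    using assms(1,2) n(2) by (rule sum_strict_mono)
  also have "\<dots> = ?S + real (card F) * d"
    by (simp add: sum.distrib)
  finally show False
    unfolding d(2) by simp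
qed

context abelian_measure_preserving_action begin

text \<open>The functions \<open>\<psi> f\<close> sum to at least \<open>1\<close> by subadditivity, and their integrals are at most
  \<open>measure M A\<close>. As the tiling splits the finite total mass into \<open>card F\<close> copies of \<open>measure M A\<close>, there
  is no room for strict inequality in either bound.\<close>

lemma tiling_invariant_decomposition:
  assumes F: "finite F" "F \<subseteq> carrier G" and A: "A \<in> sets M" and tiling: "ae_tiling M \<phi> F A"
    and "finite_measure M"
  defines "T \<equiv> \<lambda>f. \<phi> (f [^] card F)"
  defines "\<psi> \<equiv> \<lambda>f. upper_average (T f) (indicator (\<phi> f ` A))"
  shows "AE x in M. (\<Sum>f\<in>F. \<psi> f x) = 1"
    and "f \<in> F \<Longrightarrow> (\<integral>x. \<psi> f x \<partial>M) = measure M A"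
    and "f \<in> F \<Longrightarrow> ae_eq_set M (\<phi> (f [^] card F) ` A) A \<Longrightarrow>
      AE x in M. \<psi> f x = indicator (\<phi> f ` A) x"
    and "f \<in> F \<Longrightarrow> \<psi> f \<in> borel_measurable M"
proof -
  interpret finite_measure M by fact
  define u :: "'g \<Rightarrow> 'x \<Rightarrow> real" where "u f = indicator (\<phi> f ` A)" for f
  have \<psi>_eq: "\<psi> f = upper_average (T f) (u f)" for f
    by (simp add: \<psi>_def u_def)
  have u_range: "u f x \<in> {0..1}" for f x
    by (simp add: u_def indicator_def)
  have mem: "x \<in> \<phi> g ` A \<longleftrightarrow> \<phi> (inv g) x \<in> A" if "g \<in> carrier G" "x \<in> space M" for g x
    using that sets.sets_into_space[OF A] by (intro mem_translate_iff) auto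
  have u_measurable: "u f \<in> borel_measurable M" if "f \<in> F" for f
    using that F(2) A unfolding u_def by (intro borel_measurable_indicator translate_sets) auto
  have T_measurable: "T f \<in> M \<rightarrow>\<^sub>M M" and T_preserving: "distr M M (T f) = M" if "f \<in> F" for f
    using that F(2) unfolding T_def by (auto intro!: act_measurable distr_act)
  show \<psi>_measurable: "\<psi> f \<in> borel_measurable M" if "f \<in> F" for f
    unfolding \<psi>_eq
    by (rule upper_average_measurable[OF u_range[of f] T_measurable[OF that] u_measurable[OF that]])
  have T_pow: "(T f ^^ k) x = \<phi> (f [^] (card F * k)) x" if "f \<in> F" "x \<in> space M" for f k x
    using that F(2) by (auto simp: T_def act_funpow nat_pow_pow subset_iff)
  have dilate: "AE x in M. (\<Sum>f\<in>F. u f ((T f ^^ k) x)) = 1" for k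
  proof -
    \<comment> \<open>Since \<open>inv f [^] r = f [^] (card F * k) \<otimes> inv f\<close>, the dilated tiling is seen along the powers of \<open>T f\<close>.\<close>
    define r where "r = 1 - int (card F) * int k"
    have "coprime r (int (card F))"
    proof (rule coprimeI)
      fix d
      assume "d dvd r" "d dvd int (card F)"
      then have "d dvd r + int (card F) * int k"
        by simp
      then show "is_unit d"
        by (simp add: r_def)
    qed
    then have "tiles A F (\<lambda>f. inv f [^] r)"
      using F ae_tiling_imp_tiles[OF F A tiling] by (intro tiles_int_pow) auto
    then show ?thesis
      unfolding tiles_def using AE_space
    proof eventually_elim
      case (elim x)
      have "u f ((T f ^^ k) x) = of_int (indicator A (\<phi> (inv f [^] r) x))" if "f \<in> F" for f
      proof -
        have f: "f \<in> carrier G"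
          using that F(2) by auto
        have "inv f \<otimes> f [^] (card F * k) = inv f [^] r"
        proof -
          have "inv f [^] r = f [^] (int (card F * k) - 1)"
            using f int_pow_neg[OF f, of r] by (simp add: int_pow_inv r_def)
          then show ?thesis
            using f by (simp add: int_pow_diff int_pow_int m_comm del: of_nat_mult)
        qed
        then have "\<phi> (inv f) ((T f ^^ k) x) = \<phi> (inv f [^] r) x"
          using f elim(2) that by (simp add: T_pow flip: act_mult)
        moreover have "(T f ^^ k) x \<in> space M"
          using f elim(2) that by (simp add: T_pow act_in_space)
        ultimately show ?thesis
          using mem[OF f] by (simp add: u_def indicator_def)
      qed
      then have "(\<Sum>f\<in>F. u f ((T f ^^ k) x)) = of_int (\<Sum>f\<in>F. indicator A (\<phi> (inv f [^] r) x))"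
        by simp
      then show ?case
        using elim(1) by simp
    qed
  qed
  have "AE x in M. \<forall>k. (\<Sum>f\<in>F. u f ((T f ^^ k) x)) = 1"
    using dilate by (simp add: AE_all_countable)
  then have ge_1: "AE x in M. 1 \<le> (\<Sum>f\<in>F. \<psi> f x)"
  proof eventually_elim
    case (elim x)
    then have "F \<noteq> {}"
      by auto
    then show ?case
      using elim F(1) u_range unfolding \<psi>_eq by (intro sum_upper_average_ge_1) auto
  qed
  have int_u: "(\<integral>x. u f x \<partial>M) = measure M A" if "f \<in> F" for f
  proof -
    have f: "inv f \<in> carrier G" "f \<in> carrier G"
      using that F(2) by auto
    have "emeasure M (\<phi> f ` A) = emeasure M A"
      using translate_eq_vimage[OF f(2) sets.sets_into_space[OF A]] act_preserves[OF f(1) A] by simp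
    then show ?thesis
      using translate_sets[OF f(2) A] by (simp add: u_def measure_def)
  qed
  have \<psi>_range: "\<psi> f x \<in> {0..1}" for f x
    unfolding \<psi>_eq by (rule upper_average_range) (rule u_range)
  have integrable: "integrable M (\<psi> f)" "integrable M (u f)" if "f \<in> F" for f
    using \<psi>_range[of f] u_range[of f] \<psi>_measurable[OF that] u_measurable[OF that]
    by (auto intro!: integrable_const_bound[of _ 1] AE_I2)
  have int_le: "(\<integral>x. \<psi> f x \<partial>M) \<le> measure M A" if "f \<in> F" for f
    using integral_upper_average_le[OF u_range[of f] T_measurable[OF that] u_measurable[OF that]]
      T_preserving[OF that] finite_measure_axioms int_u[OF that] by (simp add: \<psi>_eq)
  have total: "(\<Sum>f\<in>F. measure M A) = measure M (space M)"
  proof -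
    have "(\<Sum>f\<in>F. measure M A) = (\<integral>x. (\<Sum>f\<in>F. u f x) \<partial>M)"
      using integrable by (simp add: int_u)
    also have "\<dots> = (\<integral>x. 1 \<partial>M)"
      using dilate[of 0] u_measurable by (intro integral_cong_AE) auto
    finally show ?thesis
      by simp
  qed
  \<comment> \<open>The excess of the sum over \<open>1\<close> has nonnegative integral, which is also a sum of nonpositive numbers.\<close>
  have excess: "(\<integral>x. (\<Sum>f\<in>F. \<psi> f x) - 1 \<partial>M) = (\<Sum>f\<in>F. (\<integral>x. \<psi> f x \<partial>M) - measure M A)"
    using integrable total by (simp add: sum_subtractf)
  have "(\<integral>x. (\<Sum>f\<in>F. \<psi> f x) - 1 \<partial>M) \<ge> 0"
    using ge_1 by (intro integral_nonneg_AE) auto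
  moreover have "(\<Sum>f\<in>F. (\<integral>x. \<psi> f x \<partial>M) - measure M A) \<le> 0"
    using int_le by (intro sum_nonpos) auto
  ultimately have zero: "(\<integral>x. (\<Sum>f\<in>F. \<psi> f x) - 1 \<partial>M) = 0"
    using excess by linarith
  have "AE x in M. (\<Sum>f\<in>F. \<psi> f x) - 1 = 0"
    using zero integrable ge_1 by (subst integral_nonneg_eq_0_iff_AE[symmetric]) auto
  then show "AE x in M. (\<Sum>f\<in>F. \<psi> f x) = 1"
    by simp
  show "(\<integral>x. \<psi> f x \<partial>M) = measure M A" if "f \<in> F" for f
  proof -
    have "(\<Sum>f\<in>F. measure M A - (\<integral>x. \<psi> f x \<partial>M)) = 0"
      using zero excess by (simp add: sum_subtractf)
    then show ?thesis
      using int_le that F(1) by (subst (asm) sum_nonneg_eq_0_iff) auto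
  qed
  show "AE x in M. \<psi> f x = indicator (\<phi> f ` A) x"
    if "f \<in> F" and stable: "ae_eq_set M (\<phi> (f [^] card F) ` A) A" for f
  proof -
    have f: "f \<in> carrier G" "f [^] card F \<in> carrier G"
      using that F(2) by auto
    have "AE x in M. x \<in> \<phi> (f [^] card F) ` A \<longleftrightarrow> x \<in> A"
      using AE_not_in[OF stable[unfolded ae_eq_set_def]] by eventually_elim auto
    from AE_act[OF f(2) this] have "AE x in M. \<phi> (f [^] card F) x \<in> \<phi> (f [^] card F) ` A \<longleftrightarrow> \<phi> (f [^] card F) x \<in> A" .
    then have "AE x in M. x \<in> A \<longleftrightarrow> T f x \<in> A"
      using AE_space
      by eventually_elim (use f in \<open>simp add: T_def mem act_in_space act_inv_cancel\<close>)
    from AE_act[OF inv_closed[OF f(1)] this]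
    have "AE x in M. u f (T f x) = u f x"
      using AE_space
    proof eventually_elim
      case (elim x)
      then have "\<phi> (inv f) (T f x) = T f (\<phi> (inv f) x)" "T f x \<in> space M"
        using f by (auto simp: T_def act_in_space intro: act_commute)
      then show ?case
        using elim f by (simp add: u_def indicator_def mem)
    qed
    from AE_act[OF nat_pow_closed[OF f(1)] this]
    have "AE x in M. \<forall>k. u f (T f (\<phi> (f [^] (card F * k)) x)) = u f (\<phi> (f [^] (card F * k)) x)"
      by (simp add: AE_all_countable)
    then show ?thesis
      using AE_space
    proof eventually_elim
      case (elim x)
      have "u f ((T f ^^ k) x) = u f x" for k
      proof (induction k)
        case (Suc k)
        then show ?case
          using elim T_pow[OF that(1) elim(2), of k] by simp
      qed simp
      then have "\<psi> f x = u f x"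
        unfolding \<psi>_eq by (rule upper_average_fixed[OF u_range[of f]])
      then show ?case
        by (simp add: u_def)
    qed
  qed
qed

end

theorem theorem1p2:
  fixes G :: "('g, 'm) monoid_scheme"
    and M :: "'x measure"
    and act :: "'g \<Rightarrow> 'x \<Rightarrow> 'x"
    and F :: "'g set"
    and A :: "'x set"
  assumes "comm_group G"
    and "measure_preserving_action G M act"
    and "finite F" and "F \<subseteq> carrier G"
    and "A \<in> sets M"
    and "ae_tiling M act F A"
  shows "(\<forall>r::int. coprime r (int (card F)) \<longrightarrow> ae_tiling M act (set_int_pow G F r) A) \<and>
    (finite_measure M \<longrightarrow>
      (\<exists>\<phi> :: 'g \<Rightarrow> 'x \<Rightarrow> real.
        (AE x in M. indicator (space M) x = (\<Sum>f\<in>F. \<phi> f x)) \<and>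
        (\<forall>f\<in>F.
          \<phi> f \<in> borel_measurable M \<and>
          (\<forall>x\<in>space M. 0 \<le> \<phi> f x \<and> \<phi> f x \<le> 1) \<and>
          (AE x in M. \<phi> f (act (f [^]\<^bsub>G\<^esub> card F) x) = \<phi> f x) \<and>
          (\<integral>x. \<phi> f x \<partial>M) = measure M A \<and>
          (ae_eq_set M (act (f [^]\<^bsub>G\<^esub> card F) ` A) A \<longrightarrow>
            (AE x in M. \<phi> f x = indicator (act f ` A) x)))))"
proof (intro conjI allI impI)
  interpret abelian_measure_preserving_action G M act
    using assms(1,2) by (simp add: abelian_measure_preserving_action_def)
  show "ae_tiling M act (set_int_pow G F r) A" if "coprime r (int (card F))" for r
    using assms(3-6) that by (rule dilation)
  assume finite: "finite_measure M"
  note decomposition = tiling_invariant_decomposition[OF assms(3-6) finite]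
  define \<psi> :: "'g \<Rightarrow> 'x \<Rightarrow> real"
    where "\<psi> f = upper_average (act (f [^]\<^bsub>G\<^esub> card F)) (indicator (act f ` A))" for f
  have range: "(indicator B x :: real) \<in> {0..1}" for B and x :: 'x
    by (simp add: indicator_def)
  have "AE x in M. indicator (space M) x = (\<Sum>f\<in>F. \<psi> f x)"
    using decomposition(1) AE_space by eventually_elim (simp add: \<psi>_def)
  moreover have "\<psi> f \<in> borel_measurable M \<and> (\<forall>x\<in>space M. 0 \<le> \<psi> f x \<and> \<psi> f x \<le> 1) \<and>
      (AE x in M. \<psi> f (act (f [^]\<^bsub>G\<^esub> card F) x) = \<psi> f x) \<and> (\<integral>x. \<psi> f x \<partial>M) = measure M A \<and>
      (ae_eq_set M (act (f [^]\<^bsub>G\<^esub> card F) ` A) A \<longrightarrow> (AE x in M. \<psi> f x = indicator (act f ` A) x))"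
    if "f \<in> F" for f
  proof -
    have "\<psi> f x \<in> {0..1}" "\<psi> f (act (f [^]\<^bsub>G\<^esub> card F) x) = \<psi> f x" for x
      unfolding \<psi>_def by (rule upper_average_range upper_average_invariant, rule range)+
    then show ?thesis
      using decomposition(2-4)[OF that] by (simp add: \<psi>_def[abs_def])
  qed
  ultimately show "\<exists>\<phi> :: 'g \<Rightarrow> 'x \<Rightarrow> real.
        (AE x in M. indicator (space M) x = (\<Sum>f\<in>F. \<phi> f x)) \<and>
        (\<forall>f\<in>F.
          \<phi> f \<in> borel_measurable M \<and>
          (\<forall>x\<in>space M. 0 \<le> \<phi> f x \<and> \<phi> f x \<le> 1) \<and>
          (AE x in M. \<phi> f (act (f [^]\<^bsub>G\<^esub> card F) x) = \<phi> f x) \<and>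
          (\<integral>x. \<phi> f x \<partial>M) = measure M A \<and>
          (ae_eq_set M (act (f [^]\<^bsub>G\<^esub> card F) ` A) A \<longrightarrow>
            (AE x in M. \<phi> f x = indicator (act f ` A) x)))"
    by blast
qed

end
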